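(* Let $g:\mathbb{R}^n\times[0,\infty)\to\mathbb{R}^n$ and consider the system $\dot x=g(x,t)$, $x\in\mathbb{R}^n$, $t\ge0$. Let $P\in\mathbb{R}^{n\times n}$ be symmetric positive-definite. Suppose that, with respect to the norm $\|\cdot\|_{2,P^{1/2}}$, $g$ is uniformly $\ell$-Lipschitz continuous and the system is contracting with contraction rate $\bar\gamma(t)$ such that $\inf_{t\ge0}\bar\gamma(t)>0$ and $\ell>\sup_{t\ge0}\bar\gamma(t)$. Let $(y_k)_{k\ge0}$ be a sequence generated by the explicit Euler discretization $y_{k+1}=y_k+h\,g(y_k,kh)$, $k=0,1,\dots$, with given $y_0\in\mathbb{R}^n$ and constant step-size $0<h<\frac{2}{\ell^2}\inf_{t\ge0}\bar\gamma(t)$. (1) If there exists $x^*\in\mathbb{R}^n$ such that $g(x^*,t)=0$ for all $t\ge0$, then for $k=1,2,\dots$ $$\|y_k-x^*\|_{2,P^{1/2}}\le\Big(\prod_{m=0}^{k-1}(1-2h\bar\gamma(mh)+h^2\ell^2)^{1/2}\Big)\|y_0-x^*\|_{2,P^{1/2}};$$ and if additionally $\bar\gamma(t)\equiv\gamma>0$, then $$\|y_k-x^*\|_{2,P^{1/2}}\le(1-2h\gamma+h^2\ell^2)^{k/2}\|y_0-x^*\|_{2,P^{1/2}}.\qquad(\mathrm{A})$$ (2) If there exists a curve $t\mapsto x^*(t)\in\mathbb{R}^n$ such that $g(x^*(t),t)=0$ for all $t\ge0$, then for $k=1,2,\dots$ $$\begin{aligned}\|y_k-x^*(kh)\|_{2,P^{1/2}}\le{}&\Big(\prod_{m=0}^{k-1}(1-2h\bar\gamma(mh)+h^2\ell^2)^{1/2}\Big)\|y_0-x^*(0)\|_{2,P^{1/2}}\\&+1_{\{k>1\}}\sum_{m=1}^{k-1}\Big(\prod_{r=m}^{k-1}(1-2h\bar\gamma(rh)+h^2\ell^2)^{1/2}\Big)\|x^*(mh)-x^*((m-1)h)\|_{2,P^{1/2}}\\&+\|x^*(kh)-x^*((k-1)h)\|_{2,P^{1/2}},\end{aligned}$$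 where $1_{\{k>1\}}=1$ if $k>1$ and $0$ otherwise. If additionally $\bar\gamma(t)\equiv\gamma>0$ and $\sup_{k=1,2,\dots}\|x^*(kh)-x^*((k-1)h)\|_{2,P^{1/2}}\le\rho$ for some constant $\rho\ge0$, then for $k=1,2,\dots$ $$\|y_k-x^*(kh)\|_{2,P^{1/2}}\le(1-2h\gamma+h^2\ell^2)^{k/2}\|y_0-x^*(0)\|_{2,P^{1/2}}+\rho\sum_{m=0}^{k-1}(1-2h\gamma+h^2\ell^2)^{m/2},\qquad(\mathrm{B})$$ and so $$\limsup_{k\to\infty}\|y_k-x^*(kh)\|_{2,P^{1/2}}\le\frac{\rho}{1-(1-2h\gamma+h^2\ell^2)^{1/2}}.\qquad(\mathrm{C})$$ (3) In all the previous cases where the contraction rate is time-invariant, $\bar\gamma(t)\equiv\gamma$, the choice of step-size that gives the fastest convergence rate (i.e. minimizes the factor $1-2h\gamma+h^2\ell^2$ in (A), (B) and (C)) is $h^*=\frac{\gamma}{\ell^2}$, for which $1-2h^*\gamma+(h^* )^2\ell^2=1-\frac{\gamma^2}{\ell^2}$.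
   Context: For symmetric positive-definite $P$, $\|x\|_{2,P^{1/2}}=\|P^{1/2}x\|_2=\sqrt{x^\top Px}$. It is assumed that a solution of $\dot x=g(x,t)$ exists for every initial condition. The vector field $g$ is uniformly $\ell$-Lipschitz continuous with respect to a norm $\|\cdot\|$ if $\ell>0$ and $\|g(x,t)-g(y,t)\|\le\ell\|x-y\|$ for all $x,y\in\mathbb{R}^n$ and every $t\ge0$. The system is contracting with respect to $\|\cdot\|_{2,P^{1/2}}$ with contraction rate $\bar\gamma(t)$ (an integrable function with $\int_{t_0}^t\bar\gamma(s)\,ds>0$ for $t>t_0$) if the one-sided Lipschitz condition $$(x-y)^\top P\,(g(x,t)-g(y,t))\le-\bar\gamma(t)\|x-y\|_{2,P^{1/2}}^2$$ holds for all $x,y\in\mathbb{R}^n$ and all $t\ge t_0$ (here $t_0=0$). *)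

theory Defs
  imports "HOL-Analysis.Analysis"
begin

definition pos_def :: "real^'n^'n \<Rightarrow> bool" where
  "pos_def P \<longleftrightarrow> transpose P = P \<and> (\<forall>x. x \<noteq> 0 \<longrightarrow> x \<bullet> (P *v x) > 0)"

definition norm_P :: "real^'n^'n \<Rightarrow> real^'n \<Rightarrow> real" where
  "norm_P P x = sqrt (x \<bullet> (P *v x))"

text \<open>The value agrees with the Euclidean norm of the square root of \<open>P\<close> applied to \<open>x\<close>.\<close>

lemma norm_P_eq_norm_square_root:
  fixes P Q :: "real^'n^'n"
  assumes "transpose Q = Q" and "Q ** Q = P"
  shows "norm_P P x = norm (Q *v x)"
proof -
  have "x \<bullet> (P *v x) = x \<bullet> (Q *v (Q *v x))"
    by (simp add: assms(2)[symmetric] matrix_vector_mul_assoc)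
  also have "\<dots> = (Q *v x) \<bullet> (Q *v x)"
    by (metis assms(1) dot_lmul_matrix transpose_matrix_vector)
  finally show ?thesis
    by (simp add: norm_P_def norm_eq_sqrt_inner)
qed

text \<open>
  Vector fields are functions \<open>g x t\<close>, of which only the values at \<open>t \<ge> 0\<close> are used.
  Solutions are taken in integral form with the Henstock-Kurzweil integral. Since \<open>g\<close> need not
  be continuous in \<open>t\<close>, this covers Caratheodory solutions, as well as all classical ones (next
  lemma). The notion only occurs as a hypothesis.
\<close>

definition solution :: "(real^'n \<Rightarrow> real \<Rightarrow> real^'n) \<Rightarrow> real^'n \<Rightarrow> (real \<Rightarrow> real^'n) \<Rightarrow> bool" where
  "solution g x0 x \<longleftrightarrow>
     x 0 = x0 \<and> (\<forall>t\<ge>0. ((\<lambda>s. g (x s) s) has_integral (x t - x0)) {0..t})"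

lemma classical_solution_imp_solution:
  assumes "x 0 = x0"
    and "\<And>t. t \<ge> 0 \<Longrightarrow> (x has_vector_derivative g (x t) t) (at t within {0..})"
  shows "solution g x0 x"
  unfolding solution_def
proof (intro conjI allI impI)
  fix t :: real
  assume "t \<ge> 0"
  then have "((\<lambda>s. g (x s) s) has_integral (x t - x 0)) {0..t}"
    by (intro fundamental_theorem_of_calculus has_vector_derivative_within_subset[OF assms(2)]) auto
  then show "((\<lambda>s. g (x s) s) has_integral (x t - x0)) {0..t}"
    by (simp add: assms(1))
qed (fact assms(1))

definition uniformly_lipschitz ::
  "(real^'n \<Rightarrow> real) \<Rightarrow> real \<Rightarrow> (real^'n \<Rightarrow> real \<Rightarrow> real^'n) \<Rightarrow> bool" where
  "uniformly_lipschitz N l g \<longleftrightarrow>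
     l > 0 \<and> (\<forall>x y. \<forall>t\<ge>0. N (g x t - g y t) \<le> l * N (x - y))"

text \<open>
  Integrability of the rate is local, i.e. on each \<open>{t0..t}\<close>: a rate that is bounded away
  from \<open>0\<close> is never integrable on the whole half-line.
\<close>

definition contraction_rate :: "real \<Rightarrow> (real \<Rightarrow> real) \<Rightarrow> bool" where
  "contraction_rate t0 c \<longleftrightarrow> (\<forall>t>t0. c integrable_on {t0..t} \<and> integral {t0..t} c > 0)"

definition contracting ::
  "real^'n^'n \<Rightarrow> real \<Rightarrow> (real \<Rightarrow> real) \<Rightarrow> (real^'n \<Rightarrow> real \<Rightarrow> real^'n) \<Rightarrow> bool" where
  "contracting P t0 c g \<longleftrightarrow> contraction_rate t0 c \<and>
     (\<forall>x y. \<forall>t\<ge>t0. (x - y) \<bullet> (P *v (g x t - g y t)) \<le> - c t * (norm_P P (x - y))\<^sup>2)"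

definition euler_sequence ::
  "(real^'n \<Rightarrow> real \<Rightarrow> real^'n) \<Rightarrow> real \<Rightarrow> (nat \<Rightarrow> real^'n) \<Rightarrow> bool" where
  "euler_sequence g h y \<longleftrightarrow> (\<forall>k. y (Suc k) = y k + h *\<^sub>R g (y k) (real k * h))"

end

theory Submission
  imports Defs
begin

text \<open>
  Expanding the square of the \<open>P\<close>-norm of \<open>y - z + h (g y t - g z t)\<close>, the contraction condition
  bounds the cross term and the Lipschitz condition the last term, so an Euler step at time \<open>t\<close>
  contracts distances by the factor \<open>q = sqrt (1 - 2 h c(t) + h\<^sup>2 l\<^sup>2)\<close>. An equilibrium at time \<open>t\<close> is
  a fixed point of this step, hence the error against the equilibrium curve satisfies
  \<open>e (k + 1) \<le> q k * e k + d (k + 1)\<close>, where \<open>d k\<close> is the displacement of the equilibrium; unrolling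
  the recursion gives all the bounds, and a fixed equilibrium is a constant curve.
\<close>

section \<open>The inner product and norm induced by \<open>P\<close>\<close>

lemma pos_def_commute:
  fixes P :: "real^'n^'n"
  assumes "pos_def P"
  shows "x \<bullet> (P *v y) = y \<bullet> (P *v x)"
  using assms unfolding pos_def_def
  by (metis dot_lmul_matrix inner_commute transpose_matrix_vector)

lemma pos_def_nonneg:
  assumes "pos_def P"
  shows "0 \<le> x \<bullet> (P *v x)"
  using assms unfolding pos_def_def by (cases "x = 0") (auto intro: less_imp_le)

lemma norm_P_nonneg [simp]: "pos_def P \<Longrightarrow> 0 \<le> norm_P P x"
  by (simp add: norm_P_def pos_def_nonneg)

lemma norm_P_square: "pos_def P \<Longrightarrow> (norm_P P x)\<^sup>2 = x \<bullet> (P *v x)"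
  by (simp add: norm_P_def pos_def_nonneg)

lemma norm_P_zero [simp]: "norm_P P 0 = 0"
  by (simp add: norm_P_def)

lemma norm_P_minus: "norm_P P (- x) = norm_P P x"
  by (simp add: norm_P_def vec.neg)

lemma norm_P_minus_commute: "norm_P P (x - y) = norm_P P (y - x)"
  using norm_P_minus[of P "x - y"] by simp

text \<open>The workhorse expansion: the optimal \<open>a\<close> gives Cauchy-Schwarz,
  \<open>a = 1\<close> the triangle inequality and \<open>a = h\<close> the Euler step.\<close>

lemma norm_P_square_add_scaleR:
  assumes "pos_def P"
  shows "(norm_P P (x + a *\<^sub>R y))\<^sup>2
    = (norm_P P x)\<^sup>2 + 2 * a * (x \<bullet> (P *v y)) + a\<^sup>2 * (norm_P P y)\<^sup>2"
  unfolding norm_P_square[OF assms]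
  by (simp add: matrix_vector_right_distrib matrix_vector_mult_scaleR inner_add_left inner_add_right
      pos_def_commute[OF assms, of y x] power2_eq_square algebra_simps)

lemma norm_P_Cauchy_Schwarz:
  assumes "pos_def P"
  shows "x \<bullet> (P *v y) \<le> norm_P P x * norm_P P y"
proof (cases "y = 0")
  case False
  let ?N = "(norm_P P y)\<^sup>2" and ?B = "x \<bullet> (P *v y)"
  have pos: "?N > 0"
    using assms False by (simp add: norm_P_square pos_def_def)
  \<comment> \<open>The coefficient \<open>- ?B / ?N\<close> minimizes the quadratic in
    \<open>a\<close>, so nonnegativity there yields the sharp inequality.\<close>
  have "0 \<le> (norm_P P (x + (- ?B / ?N) *\<^sub>R y))\<^sup>2"
    by simp
  also have "\<dots> = (norm_P P x)\<^sup>2 - ?B\<^sup>2 / ?N"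
    unfolding norm_P_square_add_scaleR[OF assms] using pos
    by (simp add: power2_eq_square field_simps)
  finally have "?B\<^sup>2 \<le> (norm_P P x * norm_P P y)\<^sup>2"
    using pos by (simp add: field_simps power_mult_distrib)
  then show ?thesis
    by (rule power2_le_imp_le) (use assms in simp)
qed simp

lemma norm_P_triangle:
  assumes "pos_def P"
  shows "norm_P P (x + y) \<le> norm_P P x + norm_P P y"
proof -
  have "(norm_P P (x + y))\<^sup>2 \<le> (norm_P P x + norm_P P y)\<^sup>2"
    using norm_P_square_add_scaleR[OF assms, of x 1 y] norm_P_Cauchy_Schwarz[OF assms, of x y]
    by (simp add: power2_sum)
  then show ?thesis
    by (rule power2_le_imp_le) (use assms in simp)
qed

section \<open>Error propagation in one Euler step\<close>

lemma euler_step_contraction: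
  assumes P: "pos_def P" and "uniformly_lipschitz (norm_P P) l g" "contracting P 0 c g"
    and "0 \<le> h" "0 \<le> t"
  shows "norm_P P (y + h *\<^sub>R g y t - (z + h *\<^sub>R g z t))
    \<le> sqrt (1 - 2 * h * c t + h\<^sup>2 * l\<^sup>2) * norm_P P (y - z)"
proof -
  let ?v = "y - z" and ?w = "g y t - g z t"
  have "h * (?v \<bullet> (P *v ?w)) \<le> h * (- c t * (norm_P P ?v)\<^sup>2)"
    using assms by (intro mult_left_mono) (auto simp: contracting_def)
  moreover have "norm_P P ?w \<le> l * norm_P P ?v"
    using assms by (auto simp: uniformly_lipschitz_def)
  then have "h\<^sup>2 * (norm_P P ?w)\<^sup>2 \<le> h\<^sup>2 * (l * norm_P P ?v)\<^sup>2"
    using P by (intro mult_left_mono power_mono) auto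
  moreover have "y + h *\<^sub>R g y t - (z + h *\<^sub>R g z t) = ?v + h *\<^sub>R ?w"
    by (simp add: algebra_simps)
  ultimately have "(norm_P P (y + h *\<^sub>R g y t - (z + h *\<^sub>R g z t)))\<^sup>2
      \<le> (1 - 2 * h * c t + h\<^sup>2 * l\<^sup>2) * (norm_P P ?v)\<^sup>2"
    using norm_P_square_add_scaleR[OF P, of ?v h ?w] by (simp add: algebra_simps power_mult_distrib)
  \<comment> \<open>Roots are taken on both sides because \<open>sqrt\<close> on the reals is
    monotone and multiplicative for arguments of any sign, so the factor splits off
    directly.\<close>
  then have "sqrt ((norm_P P (y + h *\<^sub>R g y t - (z + h *\<^sub>R g z t)))\<^sup>2)
      \<le> sqrt ((1 - 2 * h * c t + h\<^sup>2 * l\<^sup>2) * (norm_P P ?v)\<^sup>2)"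
    by (rule real_sqrt_le_mono)
  then show ?thesis
    using P by (simp add: real_sqrt_mult)
qed

lemma euler_error_recursion:
  assumes P: "pos_def P" and "uniformly_lipschitz (norm_P P) l g" "contracting P 0 c g"
    and "0 \<le> h" and y: "euler_sequence g h y" and xs: "\<forall>t\<ge>0. g (xs t) t = 0"
  shows "norm_P P (y (Suc k) - xs (real (Suc k) * h))
    \<le> sqrt (1 - 2 * h * c (real k * h) + h\<^sup>2 * l\<^sup>2) * norm_P P (y k - xs (real k * h))
      + norm_P P (xs (real (Suc k) * h) - xs (real k * h))"
proof -
  let ?t = "real k * h" and ?s = "real (Suc k) * h"
  \<comment> \<open>The old equilibrium \<open>xs ?t\<close> is the intermediate point: the step at
    time \<open>?t\<close> fixes it, and the triangle inequality then adds its move to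
    \<open>xs ?s\<close>.\<close>
  have "norm_P P (y (Suc k) - xs ?t)
      \<le> sqrt (1 - 2 * h * c ?t + h\<^sup>2 * l\<^sup>2) * norm_P P (y k - xs ?t)"
    using euler_step_contraction[OF assms(1-4), of ?t "y k" "xs ?t"] y xs \<open>0 \<le> h\<close>
    by (simp add: euler_sequence_def)
  moreover have "norm_P P (y (Suc k) - xs ?s)
      \<le> norm_P P (y (Suc k) - xs ?t) + norm_P P (xs ?s - xs ?t)"
    using norm_P_triangle[OF P, of "y (Suc k) - xs ?t" "xs ?t - xs ?s"]
    by (simp add: norm_P_minus_commute[of P "xs ?t"])
  ultimately show ?thesis
    by linarith
qed

section \<open>Scalar linear recursions\<close>

text \<open>Discrete variation of constants: a perturbation \<open>d m\<close> entering at step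
  \<open>m\<close> is damped by all later factors \<open>q m\<close>, ...,
  \<open>q (k - 1)\<close>.\<close>

lemma linear_recursion_bound:
  fixes e q d :: "nat \<Rightarrow> real"
  assumes "\<And>k. e (Suc k) \<le> q k * e k + d (Suc k)" and "\<And>k. 0 \<le> q k"
  shows "e k \<le> (\<Prod>m<k. q m) * e 0 + (\<Sum>m=1..k. (\<Prod>r=m..<k. q r) * d m)"
proof (induction k)
  case (Suc k)
  have "e (Suc k) \<le> q k * e k + d (Suc k)"
    by (rule assms)
  also have "\<dots> \<le> q k * ((\<Prod>m<k. q m) * e 0 + (\<Sum>m=1..k. (\<Prod>r=m..<k. q r) * d m)) + d (Suc k)"
    using Suc assms(2) by (intro add_right_mono mult_left_mono) auto
  \<comment> \<open>Each old product gains the factor \<open>q k\<close>; the new summand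
    \<open>d (Suc k)\<close> carries an empty product.\<close>
  also have "(\<Sum>m=1..k. (\<Prod>r=m..<Suc k. q r) * d m) = q k * (\<Sum>m=1..k. (\<Prod>r=m..<k. q r) * d m)"
    unfolding sum_distrib_left by (intro sum.cong) (auto simp: prod.atLeastLessThan_Suc)
  then have "q k * ((\<Prod>m<k. q m) * e 0 + (\<Sum>m=1..k. (\<Prod>r=m..<k. q r) * d m)) + d (Suc k)
      = (\<Prod>m<Suc k. q m) * e 0 + (\<Sum>m=1..Suc k. (\<Prod>r=m..<Suc k. q r) * d m)"
    by (simp add: algebra_simps)
  finally show ?case .
qed simp

lemma linear_recursion_bound_const:
  fixes e :: "nat \<Rightarrow> real"
  assumes "\<And>k. e (Suc k) \<le> q * e k + \<rho>" and "0 \<le> q"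
  shows "e k \<le> q ^ k * e 0 + \<rho> * (\<Sum>m<k. q ^ m)"
proof (induction k)
  case (Suc k)
  have "e (Suc k) \<le> q * (q ^ k * e 0 + \<rho> * (\<Sum>m<k. q ^ m)) + \<rho>"
    using assms(1)[of k] mult_left_mono[OF Suc assms(2)] by linarith
  also have "\<dots> = q ^ Suc k * e 0 + \<rho> * (\<Sum>m<Suc k. q ^ m)"
    \<comment> \<open>Peeling off the term \<open>m = 0\<close> isolates the latest \<rho>; the rest
      is \<open>q\<close> times the previous sum.\<close>
    unfolding sum.lessThan_Suc_shift by (simp add: sum_distrib_left algebra_simps)
  finally show ?case .
qed simp

text \<open>The explicit bound converges, as its first term vanishes and the second is a geometric
  series; \<open>limsup\<close> is monotone.\<close>

lemma linear_recursion_limsup: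
  fixes e :: "nat \<Rightarrow> real"
  assumes "\<And>k. e (Suc k) \<le> q * e k + \<rho>" and "0 \<le> q" "q < 1"
  shows "limsup (\<lambda>k. ereal (e k)) \<le> ereal (\<rho> / (1 - q))"
proof -
  have "(\<lambda>k. \<Sum>m<k. q ^ m) \<longlonglongrightarrow> 1 / (1 - q)"
    using geometric_sums[of q] assms(2,3) by (simp add: sums_def)
  moreover have "(\<lambda>k. q ^ k) \<longlonglongrightarrow> 0"
    using assms(2,3) by (intro LIMSEQ_realpow_zero)
  ultimately have "(\<lambda>k. q ^ k * e 0 + \<rho> * (\<Sum>m<k. q ^ m)) \<longlonglongrightarrow> 0 * e 0 + \<rho> * (1 / (1 - q))"
    by (intro tendsto_add tendsto_mult tendsto_const)
  then have "limsup (\<lambda>k. ereal (q ^ k * e 0 + \<rho> * (\<Sum>m<k. q ^ m))) = ereal (\<rho> / (1 - q))"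
    using assms(2,3) by (intro lim_imp_Limsup) auto
  moreover have "limsup (\<lambda>k. ereal (e k)) \<le> limsup (\<lambda>k. ereal (q ^ k * e 0 + \<rho> * (\<Sum>m<k. q ^ m)))"
    using linear_recursion_bound_const[of e q \<rho>, OF assms(1,2)]
    by (intro Limsup_mono always_eventually) auto
  ultimately show ?thesis
    by simp
qed

section \<open>The factor as a function of the step size\<close>

text \<open>At \<open>a = l\<close> the factor is the square of \<open>1 - h * l\<close>, and
  decreasing \<open>a\<close> below \<open>l\<close> strictly increases it.\<close>

lemma euler_factor_pos:
  fixes h a l :: real
  assumes "0 < h" "a < l"
  shows "0 < 1 - 2 * h * a + h\<^sup>2 * l\<^sup>2"
proof -
  have "0 \<le> (1 - h * l)\<^sup>2"
    by simp
  also have "\<dots> = 1 - 2 * h * l + h\<^sup>2 * l\<^sup>2"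
    by (simp add: power2_diff power_mult_distrib)
  also have "\<dots> < 1 - 2 * h * a + h\<^sup>2 * l\<^sup>2"
    using assms by simp
  finally show ?thesis .
qed

lemma euler_factor_less_1:
  fixes h a l :: real
  assumes "0 < h" "0 < l" "h < 2 / l\<^sup>2 * a"
  shows "1 - 2 * h * a + h\<^sup>2 * l\<^sup>2 < 1"
proof -
  have "h * l\<^sup>2 < 2 * a"
    using assms by (simp add: field_simps)
  then have "h * (h * l\<^sup>2) < h * (2 * a)"
    using assms(1) by (rule mult_strict_left_mono)
  then show ?thesis
    by (simp add: power2_eq_square algebra_simps)
qed

text \<open>Positivity matters at \<open>k = 0\<close>, since \<open>0 powr 0 = 0\<close> while
  \<open>sqrt 0 ^ 0 = 1\<close>.\<close>

lemma powr_half_of_nat: "0 < a \<Longrightarrow> a powr (real k / 2) = sqrt a ^ k"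
  by (simp add: powr_half_sqrt[symmetric] powr_realpow[symmetric] powr_powr)

lemma is_arg_min_quadratic:
  fixes l \<gamma> :: real
  assumes "0 < l" and "D (\<gamma> / l\<^sup>2)"
  shows "is_arg_min (\<lambda>h. 1 - 2 * h * \<gamma> + h\<^sup>2 * l\<^sup>2) D h \<longleftrightarrow> h = \<gamma> / l\<^sup>2"
proof -
  define f where "f h = 1 - 2 * h * \<gamma> + h\<^sup>2 * l\<^sup>2" for h
  \<comment> \<open>Completing the square shows the vertex to be the unique global minimizer, hence
    the unique one on any \<open>D\<close> containing it.\<close>
  have f: "f h = f (\<gamma> / l\<^sup>2) + (l * (h - \<gamma> / l\<^sup>2))\<^sup>2" for h
    using assms(1) unfolding f_def by (simp add: power2_eq_square field_simps)
  have "\<not> f h < f (\<gamma> / l\<^sup>2)" for h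
    using f[of h] by (simp add: not_less)
  moreover have "f (\<gamma> / l\<^sup>2) < f h" if "h \<noteq> \<gamma> / l\<^sup>2" for h
    using f[of h] that assms(1) by simp
  ultimately have "is_arg_min f D h \<longleftrightarrow> h = \<gamma> / l\<^sup>2"
    unfolding is_arg_min_def using assms(2) by auto
  then show ?thesis
    by (simp only: f_def[abs_def])
qed

theorem theorem3p4:
  fixes g :: "real^'n \<Rightarrow> real \<Rightarrow> real^'n"
    and P :: "real^'n^'n"
    and l :: real
    and c :: "real \<Rightarrow> real"
  assumes "pos_def P"
    and "\<forall>x0. \<exists>x. solution g x0 x"
    and "uniformly_lipschitz (norm_P P) l g"
    and "contracting P 0 c g"
    and "bdd_below (c ` {0..})" and "(INF t\<in>{0..}. c t) > 0"
    and "bdd_above (c ` {0..})" and "l > (SUP t\<in>{0..}. c t)"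
  shows
    "(\<forall>h y. 0 < h \<and> h < 2 / l\<^sup>2 * (INF t\<in>{0..}. c t) \<and> euler_sequence g h y \<longrightarrow>
       \<comment> \<open>constant equilibrium\<close>
       (\<forall>xs. (\<forall>t\<ge>0. g xs t = 0) \<longrightarrow>
          (\<forall>k\<ge>1. norm_P P (y k - xs)
             \<le> (\<Prod>m=0..k-1. sqrt (1 - 2 * h * c (real m * h) + h\<^sup>2 * l\<^sup>2)) * norm_P P (y 0 - xs)) \<and>
          (\<forall>\<gamma>>0. (\<forall>t\<ge>0. c t = \<gamma>) \<longrightarrow>
             (\<forall>k\<ge>1. norm_P P (y k - xs)
                \<le> (1 - 2 * h * \<gamma> + h\<^sup>2 * l\<^sup>2) powr (real k / 2) * norm_P P (y 0 - xs)))) \<and>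
       \<comment> \<open>equilibrium curve\<close>
       (\<forall>xs. (\<forall>t\<ge>0. g (xs t) t = 0) \<longrightarrow>
          (\<forall>k\<ge>1. norm_P P (y k - xs (real k * h))
             \<le> (\<Prod>m=0..k-1. sqrt (1 - 2 * h * c (real m * h) + h\<^sup>2 * l\<^sup>2)) * norm_P P (y 0 - xs 0)
               + of_bool (k > 1) *
                 (\<Sum>m=1..k-1. (\<Prod>r=m..k-1. sqrt (1 - 2 * h * c (real r * h) + h\<^sup>2 * l\<^sup>2))
                    * norm_P P (xs (real m * h) - xs (real (m - 1) * h)))
               + norm_P P (xs (real k * h) - xs (real (k - 1) * h))) \<and>
          (\<forall>\<gamma>>0. \<forall>\<rho>\<ge>0. (\<forall>t\<ge>0. c t = \<gamma>) \<and>
             bdd_above ((\<lambda>k. norm_P P (xs (real k * h) - xs (real (k - 1) * h))) ` {1..}) \<and>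
             (SUP k\<in>{1..}. norm_P P (xs (real k * h) - xs (real (k - 1) * h))) \<le> \<rho> \<longrightarrow>
             (\<forall>k\<ge>1. norm_P P (y k - xs (real k * h))
                \<le> (1 - 2 * h * \<gamma> + h\<^sup>2 * l\<^sup>2) powr (real k / 2) * norm_P P (y 0 - xs 0)
                  + \<rho> * (\<Sum>m=0..k-1. (1 - 2 * h * \<gamma> + h\<^sup>2 * l\<^sup>2) powr (real m / 2))) \<and>
             limsup (\<lambda>k. ereal (norm_P P (y k - xs (real k * h))))
                \<le> ereal (\<rho> / (1 - sqrt (1 - 2 * h * \<gamma> + h\<^sup>2 * l\<^sup>2)))))) \<and>
     \<comment> \<open>optimal step size: unique minimizer among the admissible ones\<close>
     (\<forall>\<gamma>>0. (\<forall>t\<ge>0. c t = \<gamma>) \<longrightarrow>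
        (\<forall>h. is_arg_min (\<lambda>h. 1 - 2 * h * \<gamma> + h\<^sup>2 * l\<^sup>2)
               (\<lambda>h. 0 < h \<and> h < 2 / l\<^sup>2 * (INF t\<in>{0..}. c t)) h \<longleftrightarrow> h = \<gamma> / l\<^sup>2) \<and>
        1 - 2 * (\<gamma> / l\<^sup>2) * \<gamma> + (\<gamma> / l\<^sup>2)\<^sup>2 * l\<^sup>2 = 1 - \<gamma>\<^sup>2 / l\<^sup>2)"
proof -
  note P = assms(1) and lip = assms(3) and con = assms(4)
  have l: "l > 0"
    using lip by (simp add: uniformly_lipschitz_def)
  have c_less: "c t < l" if "t \<ge> 0" for t
    using cSUP_upper[OF _ assms(7), of t] that assms(8) by simp
  have INF_const: "(INF t\<in>{0..}. c t) = \<gamma>" if "\<forall>t\<ge>0. c t = \<gamma>" for \<gamma>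
  proof -
    have "c ` {0..} = {\<gamma>}"
      using that by (auto simp: image_iff intro: exI[of _ 0])
    then show ?thesis by simp
  qed

  have curve: "norm_P P (y k - xs (real k * h))
             \<le> (\<Prod>m=0..k-1. sqrt (1 - 2 * h * c (real m * h) + h\<^sup>2 * l\<^sup>2)) * norm_P P (y 0 - xs 0)
               + of_bool (k > 1) *
                 (\<Sum>m=1..k-1. (\<Prod>r=m..k-1. sqrt (1 - 2 * h * c (real r * h) + h\<^sup>2 * l\<^sup>2))
                    * norm_P P (xs (real m * h) - xs (real (m - 1) * h)))
               + norm_P P (xs (real k * h) - xs (real (k - 1) * h))"
    if h: "0 < h" and y: "euler_sequence g h y" and xs: "\<forall>t\<ge>0. g (xs t) t = 0" and k: "k \<ge> 1"
    for h y xs and k :: nat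
  proof -
    define e where "e k = norm_P P (y k - xs (real k * h))" for k
    define q where "q k = sqrt (1 - 2 * h * c (real k * h) + h\<^sup>2 * l\<^sup>2)" for k
    define d where "d k = norm_P P (xs (real k * h) - xs (real (k - 1) * h))" for k
    have rec: "e (Suc k) \<le> q k * e k + d (Suc k)" for k
      using euler_error_recursion[OF P lip con _ y xs, of k] h by (simp add: e_def q_def d_def)
    have q: "0 \<le> q k" for k
      using euler_factor_pos[OF h c_less, of "real k * h"] h by (simp add: q_def)
    obtain n where n: "k = Suc n"
      using k by (cases k) auto
    have "e k \<le> (\<Prod>m<k. q m) * e 0 + (\<Sum>m=1..k. (\<Prod>r=m..<k. q r) * d m)"
      using rec q by (rule linear_recursion_bound)
    \<comment> \<open>The summand \<open>m = k\<close> has an empty product and splits off as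
      \<open>d k\<close>. For \<open>k = 1\<close> the remaining sum is empty, in agreement with the
      indicator.\<close>
    also have "\<dots> = (\<Prod>m=0..k-1. q m) * e 0
        + of_bool (k > 1) * (\<Sum>m=1..k-1. (\<Prod>r=m..k-1. q r) * d m) + d k"
      by (cases "n = 0")
        (simp_all add: n lessThan_Suc_atMost atLeast0AtMost atLeastLessThanSuc_atLeastAtMost)
    finally show ?thesis
      by (simp add: e_def q_def d_def)
  qed

  have curve_const: "(\<forall>k\<ge>1. norm_P P (y k - xs (real k * h))
                \<le> (1 - 2 * h * \<gamma> + h\<^sup>2 * l\<^sup>2) powr (real k / 2) * norm_P P (y 0 - xs 0)
                  + \<rho> * (\<Sum>m=0..k-1. (1 - 2 * h * \<gamma> + h\<^sup>2 * l\<^sup>2) powr (real m / 2))) \<and>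
             limsup (\<lambda>k. ereal (norm_P P (y k - xs (real k * h))))
                \<le> ereal (\<rho> / (1 - sqrt (1 - 2 * h * \<gamma> + h\<^sup>2 * l\<^sup>2)))"
    \<comment> \<open>A pointwise bound \<rho> on the displacements serves both a moving equilibrium
      and, with \<rho> equal to 0, a fixed one.\<close>
    if h: "0 < h" "h < 2 / l\<^sup>2 * (INF t\<in>{0..}. c t)" and y: "euler_sequence g h y"
      and xs: "\<forall>t\<ge>0. g (xs t) t = 0" and \<gamma>: "\<forall>t\<ge>0. c t = \<gamma>"
      and \<rho>: "\<And>k. k \<ge> 1 \<Longrightarrow> norm_P P (xs (real k * h) - xs (real (k - 1) * h)) \<le> \<rho>"
    for h y xs \<gamma> \<rho>
  proof -
    define e where "e k = norm_P P (y k - xs (real k * h))" for k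
    define a where "a = 1 - 2 * h * \<gamma> + h\<^sup>2 * l\<^sup>2"
    have a: "0 < a"
      using euler_factor_pos[of h \<gamma> l] c_less[of 0] h \<gamma> by (simp add: a_def)
    have a1: "a < 1"
      using euler_factor_less_1[of h l \<gamma>] h l INF_const[OF \<gamma>] by (simp add: a_def)
    have rec: "e (Suc k) \<le> sqrt a * e k + \<rho>" for k
      using euler_error_recursion[OF P lip con _ y xs, of k] h \<gamma> \<rho>[of "Suc k"]
      by (simp add: e_def a_def)
    have "e k \<le> a powr (real k / 2) * e 0 + \<rho> * (\<Sum>m=0..k-1. a powr (real m / 2))" if "k \<ge> 1" for k
    proof -
      \<comment> \<open>This fails for \<open>k = 0\<close>, where truncated subtraction makes the
        right side \<open>{0}\<close>.\<close>
      have "{..<k} = {0..k-1}"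
        using that by auto
      then show ?thesis
        using linear_recursion_bound_const[of e "sqrt a" \<rho> k, OF rec] a by (simp add: powr_half_of_nat)
    qed
    moreover have "limsup (\<lambda>k. ereal (e k)) \<le> ereal (\<rho> / (1 - sqrt a))"
      using a a1 by (intro linear_recursion_limsup rec) auto
    ultimately show ?thesis
      by (simp add: e_def a_def)
  qed

  have min: "is_arg_min (\<lambda>h. 1 - 2 * h * \<gamma> + h\<^sup>2 * l\<^sup>2)
      (\<lambda>h. 0 < h \<and> h < 2 / l\<^sup>2 * (INF t\<in>{0..}. c t)) h \<longleftrightarrow> h = \<gamma> / l\<^sup>2"
    if "\<gamma> > 0" "\<forall>t\<ge>0. c t = \<gamma>" for \<gamma> h
    \<comment> \<open>For a constant rate the vertex is half the upper limit on \<open>h\<close>,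
      hence admissible.\<close>
    using that l by (intro is_arg_min_quadratic) (simp_all add: INF_const divide_strict_right_mono)

  have min_value: "1 - 2 * (\<gamma> / l\<^sup>2) * \<gamma> + (\<gamma> / l\<^sup>2)\<^sup>2 * l\<^sup>2 = 1 - \<gamma>\<^sup>2 / l\<^sup>2" for \<gamma>
    using l by (simp add: power2_eq_square field_simps)

  \<comment> \<open>A real \<open>SUP\<close> is known to dominate its terms only for a family
    bounded above.\<close>
  have step_bound: "norm_P P (xs (real k * h) - xs (real (k - 1) * h)) \<le> \<rho>"
    if "bdd_above ((\<lambda>k. norm_P P (xs (real k * h) - xs (real (k - 1) * h))) ` {1..})"
      and "(SUP k\<in>{1..}. norm_P P (xs (real k * h) - xs (real (k - 1) * h))) \<le> \<rho>"
      and "k \<ge> 1" for xs h \<rho> and k :: nat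
    using cSUP_upper[OF _ that(1), of k] that(2,3) by simp

  show ?thesis
  proof (intro conjI allI impI; (elim conjE)?)
    fix h y xs \<gamma> and k :: nat
    assume h: "0 < h" "h < 2 / l\<^sup>2 * (INF t\<in>{0..}. c t)" and y: "euler_sequence g h y"
      and xs: "\<forall>t\<ge>0. g xs t = 0" and k: "k \<ge> 1"
    show "norm_P P (y k - xs)
        \<le> (\<Prod>m=0..k-1. sqrt (1 - 2 * h * c (real m * h) + h\<^sup>2 * l\<^sup>2)) * norm_P P (y 0 - xs)"
      \<comment> \<open>Along a constant curve every displacement term is
        \<open>norm_P P 0 = 0\<close>.\<close>
      using curve[OF h(1) y _ k, of "\<lambda>_. xs"] xs by simp
    assume "\<forall>t\<ge>0. c t = \<gamma>"
    then show "norm_P P (y k - xs)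
        \<le> (1 - 2 * h * \<gamma> + h\<^sup>2 * l\<^sup>2) powr (real k / 2) * norm_P P (y 0 - xs)"
      using curve_const[OF h y, of "\<lambda>_. xs" \<gamma> 0] xs k by simp
  next
    fix h y xs and k :: nat
    assume "0 < h" "euler_sequence g h y" "\<forall>t\<ge>0. g (xs t) t = 0" "k \<ge> 1"
    then show "norm_P P (y k - xs (real k * h))
             \<le> (\<Prod>m=0..k-1. sqrt (1 - 2 * h * c (real m * h) + h\<^sup>2 * l\<^sup>2)) * norm_P P (y 0 - xs 0)
               + of_bool (k > 1) *
                 (\<Sum>m=1..k-1. (\<Prod>r=m..k-1. sqrt (1 - 2 * h * c (real r * h) + h\<^sup>2 * l\<^sup>2))
                    * norm_P P (xs (real m * h) - xs (real (m - 1) * h)))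
               + norm_P P (xs (real k * h) - xs (real (k - 1) * h))"
      by (rule curve)
  next
    fix h y xs \<gamma> \<rho>
    assume h: "0 < h" "h < 2 / l\<^sup>2 * (INF t\<in>{0..}. c t)" and y: "euler_sequence g h y"
      and xs: "\<forall>t\<ge>0. g (xs t) t = 0" and \<gamma>: "\<forall>t\<ge>0. c t = \<gamma>"
      and "bdd_above ((\<lambda>k. norm_P P (xs (real k * h) - xs (real (k - 1) * h))) ` {1..})"
      and "(SUP k\<in>{1..}. norm_P P (xs (real k * h) - xs (real (k - 1) * h))) \<le> \<rho>"
    note bounds = curve_const[OF h y xs \<gamma> step_bound[OF this(6,7)]]
    show "limsup (\<lambda>k. ereal (norm_P P (y k - xs (real k * h))))
        \<le> ereal (\<rho> / (1 - sqrt (1 - 2 * h * \<gamma> + h\<^sup>2 * l\<^sup>2)))"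
      using bounds by blast
    fix k :: nat
    assume "k \<ge> 1"
    then show "norm_P P (y k - xs (real k * h))
        \<le> (1 - 2 * h * \<gamma> + h\<^sup>2 * l\<^sup>2) powr (real k / 2) * norm_P P (y 0 - xs 0)
          + \<rho> * (\<Sum>m=0..k-1. (1 - 2 * h * \<gamma> + h\<^sup>2 * l\<^sup>2) powr (real m / 2))"
      using bounds by blast
  qed (use min min_value in blast)+
qed

end
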